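(* Let $k\ge1$ be an integer, let $\mathcal{P}_k$ be the class of $k$-polymatroids, and let $\mathcal{P}\subseteq\mathcal{P}_k$ be a minor-closed subclass. Then there exists a unique map $U:\mathcal{P}\to\mathbb{Z}[x,y,a,b]$ such that for every $P\in\mathcal{P}$ and every $e\in E(P)$, $$U(P)=\begin{cases}1,&\text{if }P=\emptyset,\\ a^{k-\Delta(e)}x^{\Delta(e)}\,U(P\setminus e)+b^{k-m(e)}y^{m(e)}\,U(P/e),&\text{otherwise,}\end{cases}$$ where $\Delta(e)=r(P)-r(P\setminus e)$ and $m(e)=k-r(e)$. Moreover, for $P=(E,r)\in\mathcal{P}$, $$U(P;x,y,a,b)=a^{k|E|-r(P)}\,b^{r(P)}\,T_k\!\left(P;\frac{x+b}{b},\frac{y+a}{a}\right).$$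
   Context: A polymatroid is a pair $P=(E,r)$ with $E=E(P)$ a finite set and $r:2^E\to\mathbb{Z}$ such that $r(\emptyset)=0$, $r(A)\le r(B)$ whenever $A\subseteq B$, and $r(A)+r(B)\ge r(A\cup B)+r(A\cap B)$ for all $A,B\subseteq E$. It is a $k$-polymatroid if $r(e):=r(\{e\})\le k$ for all $e\in E$. Write $r(P)=r(E)$; $P=\emptyset$ means that the groundset is empty (the condition $U(\emptyset)=1$ is imposed for the empty polymatroid, and the recursion is required for every nonempty $P$ and every $e\in E(P)$). Deletion: $P\setminus A=(E\setminus A,\,r|_{2^{E\setminus A}})$. Contraction: $P/A=(E\setminus A,r_{P/A})$ with $r_{P/A}(X)=r(X\cup A)-r(A)$. Write $P\setminus e$, $P/e$ for $A=\{e\}$. A minor of $P$ is any polymatroid $(P/A)\setminus B$ with $A,B\subseteq E$ disjoint; minor-closed means closed under taking minors. $k$-polymatroid Tutte polynomial: $T_k(P;x,y)=\sum_{A\subseteq E}(x-1)^{r(E)-r(A)}(y-1)^{k|A|-r(A)}$. *)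

theory Defs
  imports
    "HOL-Library.FuncSet"
    "HOL-Library.Numeral_Type"
    "HOL-Library.Poly_Mapping"
    "HOL-Computational_Algebra.Polynomial_Factorial"
begin

text \<open>
  A polymatroid is a pair of a groundset and a rank function on its subsets. The rank function is
  extensional (\<^const>\<open>undefined\<close> outside the powerset of the groundset), so that equality of
  pairs is equality of polymatroids.
\<close>

type_synonym 'a polymatroid = "'a set \<times> ('a set \<Rightarrow> int)"

abbreviation ground :: "'a polymatroid \<Rightarrow> 'a set" where
  "ground P \<equiv> fst P"

abbreviation rank :: "'a polymatroid \<Rightarrow> 'a set \<Rightarrow> int" where
  "rank P \<equiv> snd P"

definition is_polymatroid :: "'a polymatroid \<Rightarrow> bool" where
  "is_polymatroid P \<longleftrightarrow>
     finite (ground P) \<and>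
     rank P \<in> Pow (ground P) \<rightarrow>\<^sub>E UNIV \<and>
     rank P {} = 0 \<and>
     (\<forall>A B. A \<subseteq> B \<and> B \<subseteq> ground P \<longrightarrow> rank P A \<le> rank P B) \<and>
     (\<forall>A B. A \<subseteq> ground P \<and> B \<subseteq> ground P \<longrightarrow>
        rank P A + rank P B \<ge> rank P (A \<union> B) + rank P (A \<inter> B))"

definition k_polymatroids :: "int \<Rightarrow> 'a polymatroid set" where
  "k_polymatroids k = {P. is_polymatroid P \<and> (\<forall>e\<in>ground P. rank P {e} \<le> k)}"

definition deletion :: "'a polymatroid \<Rightarrow> 'a set \<Rightarrow> 'a polymatroid" where
  "deletion P A = (ground P - A, restrict (rank P) (Pow (ground P - A)))"

definition contraction :: "'a polymatroid \<Rightarrow> 'a set \<Rightarrow> 'a polymatroid" where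
  "contraction P A =
     (ground P - A, \<lambda>X\<in>Pow (ground P - A). rank P (X \<union> A) - rank P A)"

definition is_minor :: "'a polymatroid \<Rightarrow> 'a polymatroid \<Rightarrow> bool" where
  "is_minor Q P \<longleftrightarrow>
     (\<exists>A B. A \<subseteq> ground P \<and> B \<subseteq> ground P \<and> A \<inter> B = {} \<and> Q = deletion (contraction P A) B)"

definition minor_closed :: "'a polymatroid set \<Rightarrow> bool" where
  "minor_closed \<P> \<longleftrightarrow> (\<forall>P\<in>\<P>. \<forall>Q. is_minor Q P \<longrightarrow> Q \<in> \<P>)"

definition total_rank :: "'a polymatroid \<Rightarrow> int" where
  "total_rank P = rank P (ground P)"

definition Delta :: "'a polymatroid \<Rightarrow> 'a \<Rightarrow> int" where
  "Delta P e = total_rank P - total_rank (deletion P {e})"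

definition rank_deficit :: "int \<Rightarrow> 'a polymatroid \<Rightarrow> 'a \<Rightarrow> int" where
  "rank_deficit k P e = k - rank P {e}"

text \<open>
  The polynomial \<open>T\<^sub>k(P; x, y)\<close> is given by its values at arguments in an arbitrary commutative
  ring. For a \<open>k\<close>-polymatroid the integers under \<^const>\<open>nat\<close> are nonnegative.
\<close>

definition tutte :: "int \<Rightarrow> 'a polymatroid \<Rightarrow> 'r::comm_ring_1 \<Rightarrow> 'r \<Rightarrow> 'r" where
  "tutte k P x y =
     (\<Sum>A\<in>Pow (ground P).
        (x - 1) ^ nat (total_rank P - rank P A) * (y - 1) ^ nat (k * int (card A) - rank P A))"

text \<open>
  \<open>\<int>[x, y, a, b]\<close>: integer-valued finitely supported functions on exponent vectors in \<open>\<nat>\<^sup>4\<close>, with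
  convolution product. The four variables are indexed by the four-element numeral type.
\<close>

type_synonym poly4 = "(4 \<Rightarrow>\<^sub>0 nat) \<Rightarrow>\<^sub>0 int"

definition indet :: "4 \<Rightarrow> poly4" where
  "indet i = Poly_Mapping.single (Poly_Mapping.single i 1) 1"

abbreviation var_x :: poly4 where "var_x \<equiv> indet 0"
abbreviation var_y :: poly4 where "var_y \<equiv> indet 1"
abbreviation var_a :: poly4 where "var_a \<equiv> indet 2"
abbreviation var_b :: poly4 where "var_b \<equiv> indet 3"

definition satisfies_recursion ::
    "int \<Rightarrow> 'a polymatroid set \<Rightarrow> ('a polymatroid \<Rightarrow> poly4) \<Rightarrow> bool" where
  "satisfies_recursion k \<P> U \<longleftrightarrow>
     (\<forall>P\<in>\<P>.
        (ground P = {} \<longrightarrow> U P = 1) \<and>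
        (\<forall>e\<in>ground P.
           U P = var_a ^ nat (k - Delta P e) * var_x ^ nat (Delta P e) * U (deletion P {e})
               + var_b ^ nat (k - rank_deficit k P e) * var_y ^ nat (rank_deficit k P e) * U (contraction P {e})))"

end

theory Submission
  imports Defs
begin

text \<open>
  Expanding \<open>T\<^sub>k\<close> and clearing denominators turns the right-hand side of the formula into
  \<open>\<Sum>A\<subseteq>E. a\<^bsup>k|E - A| - (r(E) - r(A))\<^esup> x\<^bsup>r(E) - r(A)\<^esup> b\<^bsup>r(A)\<^esup> y\<^bsup>k|A| - r(A)\<^esup>\<close>, whose exponents are
  all nonnegative because \<open>r(E) - r(A) \<le> k|E - A|\<close>. The subsets avoiding \<open>e\<close> contribute the deletion
  term of the recursion and those containing \<open>e\<close> the contraction term, so this polynomial satisfies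
  the recursion. Uniqueness holds since the recursion strictly shrinks the groundset.
\<close>


section \<open>Rank inequalities\<close>

lemma is_polymatroid_finite: "is_polymatroid P \<Longrightarrow> finite (ground P)"
  by (simp add: is_polymatroid_def)

lemma is_polymatroid_rank_empty: "is_polymatroid P \<Longrightarrow> rank P {} = 0"
  by (simp add: is_polymatroid_def)

lemma is_polymatroid_rank_mono:
  "is_polymatroid P \<Longrightarrow> A \<subseteq> B \<Longrightarrow> B \<subseteq> ground P \<Longrightarrow> rank P A \<le> rank P B"
  by (simp add: is_polymatroid_def)

lemma is_polymatroid_submodular:
  "is_polymatroid P \<Longrightarrow> A \<subseteq> ground P \<Longrightarrow> B \<subseteq> ground P \<Longrightarrow>
     rank P (A \<union> B) + rank P (A \<inter> B) \<le> rank P A + rank P B"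
  by (simp add: is_polymatroid_def)

lemma is_polymatroid_rank_nonneg:
  assumes "is_polymatroid P" "A \<subseteq> ground P"
  shows "0 \<le> rank P A"
  using is_polymatroid_rank_mono[OF assms(1) empty_subsetI assms(2)]
  by (simp add: is_polymatroid_rank_empty[OF assms(1)])

lemma is_polymatroid_rank_subadditive:
  assumes "is_polymatroid P" "A \<subseteq> ground P" "B \<subseteq> ground P"
  shows "rank P (A \<union> B) \<le> rank P A + rank P B"
proof -
  have "0 \<le> rank P (A \<inter> B)"
    using assms by (intro is_polymatroid_rank_nonneg) auto
  then show ?thesis
    using is_polymatroid_submodular[OF assms] by linarith
qed

lemma k_polymatroids_is_polymatroid: "P \<in> k_polymatroids k \<Longrightarrow> is_polymatroid P"
  by (simp add: k_polymatroids_def)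

lemma k_polymatroids_rank_singleton_le:
  "P \<in> k_polymatroids k \<Longrightarrow> e \<in> ground P \<Longrightarrow> rank P {e} \<le> k"
  by (simp add: k_polymatroids_def)

lemma k_polymatroids_rank_le_card:
  assumes P: "P \<in> k_polymatroids k" and A: "A \<subseteq> ground P"
  shows "rank P A \<le> k * int (card A)"
proof -
  note polymatroid = k_polymatroids_is_polymatroid[OF P]
  have "finite A"
    using A is_polymatroid_finite[OF polymatroid] finite_subset by blast
  then show ?thesis
    using A
  proof (induction A rule: finite_induct)
    case empty
    then show ?case
      by (simp add: is_polymatroid_rank_empty[OF polymatroid])
  next
    case (insert e A)
    have "rank P (insert e A) \<le> rank P {e} + rank P A"
      using is_polymatroid_rank_subadditive[OF polymatroid, of "{e}" A] insert.prems by simp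
    also have "\<dots> \<le> k + k * int (card A)"
      using insert k_polymatroids_rank_singleton_le[OF P] by (intro add_mono) auto
    finally show ?case
      using insert.hyps by (simp add: algebra_simps)
  qed
qed


section \<open>Deletion and contraction\<close>

lemma ground_deletion [simp]: "ground (deletion P B) = ground P - B"
  by (simp add: deletion_def)

lemma ground_contraction [simp]: "ground (contraction P B) = ground P - B"
  by (simp add: contraction_def)

lemma rank_deletion: "A \<subseteq> ground P - B \<Longrightarrow> rank (deletion P B) A = rank P A"
  by (simp add: deletion_def)

lemma rank_contraction:
  "A \<subseteq> ground P - B \<Longrightarrow> rank (contraction P B) A = rank P (A \<union> B) - rank P B"
  by (simp add: contraction_def)

lemma is_polymatroid_deletion:
  assumes "is_polymatroid P"
  shows "is_polymatroid (deletion P B)"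
  unfolding is_polymatroid_def ground_deletion
proof (intro conjI allI impI; (elim conjE)?)
  show "rank (deletion P B) \<in> Pow (ground P - B) \<rightarrow>\<^sub>E UNIV"
    by (simp add: deletion_def)
next
  fix X Y assume XY: "X \<subseteq> Y" "Y \<subseteq> ground P - B"
  then have "X \<subseteq> ground P - B" "Y \<subseteq> ground P" by auto
  then show "rank (deletion P B) X \<le> rank (deletion P B) Y"
    using is_polymatroid_rank_mono[OF assms, of X Y] XY by (simp add: rank_deletion)
next
  fix X Y assume XY: "X \<subseteq> ground P - B" "Y \<subseteq> ground P - B"
  then have "X \<subseteq> ground P" "Y \<subseteq> ground P" "X \<union> Y \<subseteq> ground P - B" "X \<inter> Y \<subseteq> ground P - B"
    by auto
  then show "rank (deletion P B) (X \<union> Y) + rank (deletion P B) (X \<inter> Y)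
      \<le> rank (deletion P B) X + rank (deletion P B) Y"
    using is_polymatroid_submodular[OF assms, of X Y] XY by (simp add: rank_deletion)
qed (use assms in \<open>simp_all add: rank_deletion is_polymatroid_finite is_polymatroid_rank_empty\<close>)

lemma is_polymatroid_contraction:
  assumes "is_polymatroid P" "B \<subseteq> ground P"
  shows "is_polymatroid (contraction P B)"
  unfolding is_polymatroid_def ground_contraction
proof (intro conjI allI impI; (elim conjE)?)
  show "rank (contraction P B) \<in> Pow (ground P - B) \<rightarrow>\<^sub>E UNIV"
    by (simp add: contraction_def)
next
  fix X Y assume XY: "X \<subseteq> Y" "Y \<subseteq> ground P - B"
  then have "rank P (X \<union> B) \<le> rank P (Y \<union> B)"
    using assms by (intro is_polymatroid_rank_mono) auto
  moreover have "X \<subseteq> ground P - B"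
    using XY by blast
  ultimately show "rank (contraction P B) X \<le> rank (contraction P B) Y"
    using XY by (simp add: rank_contraction)
next
  fix X Y assume XY: "X \<subseteq> ground P - B" "Y \<subseteq> ground P - B"
  have "rank P ((X \<union> B) \<union> (Y \<union> B)) + rank P ((X \<union> B) \<inter> (Y \<union> B))
      \<le> rank P (X \<union> B) + rank P (Y \<union> B)"
    using assms XY by (intro is_polymatroid_submodular) auto
  moreover have "(X \<union> B) \<union> (Y \<union> B) = (X \<union> Y) \<union> B" "(X \<union> B) \<inter> (Y \<union> B) = (X \<inter> Y) \<union> B"
    by auto
  moreover have "X \<union> Y \<subseteq> ground P - B" "X \<inter> Y \<subseteq> ground P - B"
    using XY by auto
  ultimately show "rank (contraction P B) (X \<union> Y) + rank (contraction P B) (X \<inter> Y)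
      \<le> rank (contraction P B) X + rank (contraction P B) Y"
    using XY by (simp add: rank_contraction)
qed (use assms in \<open>simp_all add: rank_contraction is_polymatroid_finite\<close>)

lemma deletion_in_k_polymatroids:
  assumes "P \<in> k_polymatroids k"
  shows "deletion P B \<in> k_polymatroids k"
  using assms by (simp add: k_polymatroids_def is_polymatroid_deletion rank_deletion)

lemma contraction_in_k_polymatroids:
  assumes P: "P \<in> k_polymatroids k" and B: "B \<subseteq> ground P"
  shows "contraction P B \<in> k_polymatroids k"
proof -
  note polymatroid = k_polymatroids_is_polymatroid[OF P]
  have "rank (contraction P B) {e} \<le> k" if "e \<in> ground P - B" for e
  proof -
    have "rank P ({e} \<union> B) \<le> rank P {e} + rank P B"
      using that B by (intro is_polymatroid_rank_subadditive[OF polymatroid]) auto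
    then show ?thesis
      using that k_polymatroids_rank_singleton_le[OF P, of e] by (simp add: rank_contraction)
  qed
  then show ?thesis
    by (simp add: k_polymatroids_def is_polymatroid_contraction[OF polymatroid B])
qed

lemma minor_closed_deletion:
  assumes "minor_closed \<P>" "P \<in> \<P>" "is_polymatroid P" "B \<subseteq> ground P"
  shows "deletion P B \<in> \<P>"
proof -
  have "deletion P B = deletion (contraction P {}) B"
    by (auto simp: deletion_def contraction_def is_polymatroid_rank_empty[OF assms(3)] fun_eq_iff)
  then have "is_minor (deletion P B) P"
    using assms(4) unfolding is_minor_def by blast
  then show ?thesis
    using assms(1,2) unfolding minor_closed_def by blast
qed

lemma minor_closed_contraction:
  assumes "minor_closed \<P>" "P \<in> \<P>" "B \<subseteq> ground P"
  shows "contraction P B \<in> \<P>"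
proof -
  have "contraction P B = deletion (contraction P B) {}"
    by (auto simp: deletion_def contraction_def fun_eq_iff)
  then have "is_minor (contraction P B) P"
    using assms(3) unfolding is_minor_def by blast
  then show ?thesis
    using assms(1,2) unfolding minor_closed_def by blast
qed

lemma minor_closed_induct [consumes 3, case_names empty minors]:
  assumes "P \<in> \<P>"
    and minor_closed: "minor_closed \<P>"
    and polymatroids: "\<P> \<subseteq> {P. is_polymatroid P}"
    and empty: "\<And>P. P \<in> \<P> \<Longrightarrow> ground P = {} \<Longrightarrow> \<Phi> P"
    and minors: "\<And>P e. P \<in> \<P> \<Longrightarrow> e \<in> ground P \<Longrightarrow>
      \<Phi> (deletion P {e}) \<Longrightarrow> \<Phi> (contraction P {e}) \<Longrightarrow> \<Phi> P"
  shows "\<Phi> P"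
  using \<open>P \<in> \<P>\<close>
proof (induction "card (ground P)" arbitrary: P rule: less_induct)
  case less
  have polymatroid: "is_polymatroid P"
    using less.prems polymatroids by blast
  show ?case
  proof (cases "ground P = {}")
    case True
    then show ?thesis
      by (rule empty[OF less.prems])
  next
    case False
    then obtain e where e: "e \<in> ground P" by blast
    have "card (ground P - {e}) < card (ground P)"
      using e by (intro card_Diff1_less is_polymatroid_finite polymatroid)
    moreover have "deletion P {e} \<in> \<P>" "contraction P {e} \<in> \<P>"
      using e minor_closed_deletion[OF minor_closed less.prems polymatroid]
        minor_closed_contraction[OF minor_closed less.prems] by simp_all
    ultimately show ?thesis
      by (intro minors[OF less.prems e] less.hyps) simp_all
  qed
qed


section \<open>Corank, nullity and conullity\<close>

definition corank :: "'a polymatroid \<Rightarrow> 'a set \<Rightarrow> int" where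
  "corank P A = total_rank P - rank P A"

definition nullity :: "int \<Rightarrow> 'a polymatroid \<Rightarrow> 'a set \<Rightarrow> int" where
  "nullity k P A = k * int (card A) - rank P A"

text \<open>The rank of \<open>E - A\<close> in the \<open>k\<close>-dual of \<open>P\<close>.\<close>

definition conullity :: "int \<Rightarrow> 'a polymatroid \<Rightarrow> 'a set \<Rightarrow> int" where
  "conullity k P A = k * int (card (ground P - A)) - corank P A"

lemma rank_add_corank: "rank P A + corank P A = total_rank P"
  by (simp add: corank_def)

lemma conullity_add_nullity:
  assumes "finite (ground P)" "A \<subseteq> ground P"
  shows "conullity k P A + nullity k P A = k * int (card (ground P)) - total_rank P"
proof -
  have "card (ground P) = card (ground P - A) + card A"
    using assms by (simp add: card_Diff_subset card_mono finite_subset)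
  then show ?thesis
    by (simp add: conullity_def nullity_def corank_def distrib_left)
qed

lemma corank_nonneg:
  assumes "is_polymatroid P" "A \<subseteq> ground P"
  shows "0 \<le> corank P A"
  using is_polymatroid_rank_mono[OF assms subset_refl] by (simp add: corank_def total_rank_def)

lemma nullity_nonneg:
  assumes "P \<in> k_polymatroids k" "A \<subseteq> ground P"
  shows "0 \<le> nullity k P A"
  using k_polymatroids_rank_le_card[OF assms] by (simp add: nullity_def)

lemma conullity_nonneg:
  assumes P: "P \<in> k_polymatroids k" and A: "A \<subseteq> ground P"
  shows "0 \<le> conullity k P A"
proof -
  have "total_rank P = rank P (A \<union> (ground P - A))"
    using A by (simp add: total_rank_def Un_absorb1)
  also have "\<dots> \<le> rank P A + rank P (ground P - A)"
    using A by (intro is_polymatroid_rank_subadditive k_polymatroids_is_polymatroid[OF P]) auto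
  also have "\<dots> \<le> rank P A + k * int (card (ground P - A))"
    using k_polymatroids_rank_le_card[OF P, of "ground P - A"] by simp
  finally show ?thesis
    by (simp add: conullity_def corank_def)
qed

lemma nullity_deletion:
  "A \<subseteq> ground P - B \<Longrightarrow> nullity k (deletion P B) A = nullity k P A"
  by (simp add: nullity_def rank_deletion)

lemma corank_deletion:
  "A \<subseteq> ground P - B \<Longrightarrow> corank P A = corank P (ground P - B) + corank (deletion P B) A"
  by (simp add: corank_def total_rank_def rank_deletion)

lemma conullity_deletion:
  assumes "finite (ground P)" "B \<subseteq> ground P" "A \<subseteq> ground P - B"
  shows "conullity k P A = conullity k P (ground P - B) + conullity k (deletion P B) A"
proof -
  have "ground P - A = B \<union> (ground P - B - A)"
    using assms by blast
  moreover have "card (B \<union> (ground P - B - A)) = card B + card (ground P - B - A)"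
    using assms by (intro card_Un_disjoint) (auto intro: finite_subset)
  moreover have "ground P - (ground P - B) = B"
    using assms by blast
  ultimately show ?thesis
    using corank_deletion[OF assms(3)] by (simp add: conullity_def distrib_left)
qed

lemma corank_contraction:
  assumes "B \<subseteq> ground P" "A \<subseteq> ground P - B"
  shows "corank (contraction P B) A = corank P (A \<union> B)"
  using assms by (simp add: corank_def total_rank_def rank_contraction Un_absorb2)

lemma conullity_contraction:
  assumes "B \<subseteq> ground P" "A \<subseteq> ground P - B"
  shows "conullity k (contraction P B) A = conullity k P (A \<union> B)"
proof -
  have "ground P - B - A = ground P - (A \<union> B)" by blast
  then show ?thesis
    by (simp add: conullity_def corank_contraction[OF assms])
qed

lemma nullity_contraction:
  assumes "finite (ground P)" "B \<subseteq> ground P" "A \<subseteq> ground P - B"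
  shows "nullity k P (A \<union> B) = nullity k P B + nullity k (contraction P B) A"
proof -
  have "card (A \<union> B) = card A + card B"
    using assms by (intro card_Un_disjoint) (auto intro: finite_subset)
  then show ?thesis
    using assms(3) by (simp add: nullity_def rank_contraction distrib_left)
qed

lemma corank_remove: "corank P (ground P - {e}) = Delta P e"
  by (simp add: corank_def Delta_def total_rank_def rank_deletion)

lemma conullity_remove:
  assumes "e \<in> ground P"
  shows "conullity k P (ground P - {e}) = k - Delta P e"
proof -
  have "ground P - (ground P - {e}) = {e}"
    using assms by blast
  then show ?thesis
    by (simp add: conullity_def corank_remove)
qed


section \<open>The universal polynomial\<close>

definition subset_monomial ::
    "int \<Rightarrow> 'a polymatroid \<Rightarrow> 'r::comm_semiring_1 \<Rightarrow> 'r \<Rightarrow> 'r \<Rightarrow> 'r \<Rightarrow> 'a set \<Rightarrow> 'r" where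
  "subset_monomial k P x y a b A =
     a ^ nat (conullity k P A) * x ^ nat (corank P A) * b ^ nat (rank P A) * y ^ nat (nullity k P A)"

definition universal_tutte ::
    "int \<Rightarrow> 'a polymatroid \<Rightarrow> 'r::comm_semiring_1 \<Rightarrow> 'r \<Rightarrow> 'r \<Rightarrow> 'r \<Rightarrow> 'r" where
  "universal_tutte k P x y a b = (\<Sum>A\<in>Pow (ground P). subset_monomial k P x y a b A)"

lemma power_nat_add:
  fixes x :: "'r::monoid_mult"
  assumes "0 \<le> i" "0 \<le> j"
  shows "x ^ nat (i + j) = x ^ nat i * x ^ nat j"
  using assms by (simp add: nat_add_distrib power_add)

lemma subset_monomial_deletion:
  assumes P: "P \<in> k_polymatroids k" and B: "B \<subseteq> ground P" and A: "A \<subseteq> ground P - B"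
  shows "subset_monomial k P x y a b A =
    a ^ nat (conullity k P (ground P - B)) * x ^ nat (corank P (ground P - B))
    * subset_monomial k (deletion P B) x y a b A"
proof -
  note deletion_mem = deletion_in_k_polymatroids[OF P, of B]
  note polymatroid = k_polymatroids_is_polymatroid[OF P]
    k_polymatroids_is_polymatroid[OF deletion_mem]
  have "a ^ nat (conullity k P A) =
      a ^ nat (conullity k P (ground P - B)) * a ^ nat (conullity k (deletion P B) A)"
    unfolding conullity_deletion[OF is_polymatroid_finite[OF polymatroid(1)] B A]
    using A by (intro power_nat_add conullity_nonneg P deletion_mem) simp_all
  moreover have "x ^ nat (corank P A) =
      x ^ nat (corank P (ground P - B)) * x ^ nat (corank (deletion P B) A)"
    unfolding corank_deletion[OF A] using A by (intro power_nat_add corank_nonneg polymatroid) simp_all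
  ultimately show ?thesis
    by (simp add: subset_monomial_def rank_deletion[OF A] nullity_deletion[OF A] mult_ac)
qed

lemma subset_monomial_contraction:
  assumes P: "P \<in> k_polymatroids k" and B: "B \<subseteq> ground P" and A: "A \<subseteq> ground P - B"
  shows "subset_monomial k P x y a b (A \<union> B) =
    b ^ nat (rank P B) * y ^ nat (nullity k P B) * subset_monomial k (contraction P B) x y a b A"
proof -
  note contraction_mem = contraction_in_k_polymatroids[OF P B]
  note polymatroid = k_polymatroids_is_polymatroid[OF P]
    k_polymatroids_is_polymatroid[OF contraction_mem]
  have "b ^ nat (rank P B + rank (contraction P B) A) =
      b ^ nat (rank P B) * b ^ nat (rank (contraction P B) A)"
    using A B by (intro power_nat_add is_polymatroid_rank_nonneg polymatroid) simp_all
  then have "b ^ nat (rank P (A \<union> B)) =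
      b ^ nat (rank P B) * b ^ nat (rank (contraction P B) A)"
    by (simp add: rank_contraction[OF A])
  moreover have "y ^ nat (nullity k P (A \<union> B)) =
      y ^ nat (nullity k P B) * y ^ nat (nullity k (contraction P B) A)"
    unfolding nullity_contraction[OF is_polymatroid_finite[OF polymatroid(1)] B A]
    using A B by (intro power_nat_add nullity_nonneg P contraction_mem) simp_all
  ultimately show ?thesis
    by (simp add: subset_monomial_def corank_contraction[OF B A] conullity_contraction[OF B A] mult_ac)
qed

lemma sum_Pow_insert:
  assumes "finite A" "e \<notin> A"
  shows "sum f (Pow (insert e A)) = sum f (Pow A) + (\<Sum>B\<in>Pow A. f (insert e B))"
proof -
  have "inj_on (insert e) (Pow A)"
    using assms(2) by (auto simp: inj_on_def)
  moreover have "Pow A \<inter> insert e ` Pow A = {}"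
    using assms(2) by blast
  ultimately show ?thesis
    using assms(1) by (simp add: Pow_insert sum.union_disjoint sum.reindex)
qed

lemma universal_tutte_empty:
  assumes "is_polymatroid P" "ground P = {}"
  shows "universal_tutte k P x y a b = 1"
  using assms
  by (simp add: universal_tutte_def subset_monomial_def conullity_def corank_def nullity_def
      total_rank_def is_polymatroid_rank_empty)

lemma universal_tutte_recursion:
  assumes P: "P \<in> k_polymatroids k" and e: "e \<in> ground P"
  shows "universal_tutte k P x y a b =
      a ^ nat (k - Delta P e) * x ^ nat (Delta P e) * universal_tutte k (deletion P {e}) x y a b
    + b ^ nat (k - rank_deficit k P e) * y ^ nat (rank_deficit k P e)
        * universal_tutte k (contraction P {e}) x y a b"
proof -
  let ?F = "ground P - {e}" and ?f = "subset_monomial k P x y a b"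
  have "finite ?F"
    using is_polymatroid_finite[OF k_polymatroids_is_polymatroid[OF P]] by simp
  then have "sum ?f (Pow (insert e ?F)) =
      (\<Sum>A\<in>Pow ?F. ?f A) + (\<Sum>A\<in>Pow ?F. ?f (insert e A))"
    by (intro sum_Pow_insert) auto
  then have "universal_tutte k P x y a b = (\<Sum>A\<in>Pow ?F. ?f A) + (\<Sum>A\<in>Pow ?F. ?f (insert e A))"
    using e by (simp add: universal_tutte_def insert_absorb)
  also have "(\<Sum>A\<in>Pow ?F. ?f A) =
      a ^ nat (k - Delta P e) * x ^ nat (Delta P e) * universal_tutte k (deletion P {e}) x y a b"
    unfolding universal_tutte_def sum_distrib_left using subset_monomial_deletion[OF P, of "{e}"] e
    by (intro sum.cong) (simp_all add: corank_remove conullity_remove)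
  also have "(\<Sum>A\<in>Pow ?F. ?f (insert e A)) =
      b ^ nat (rank P {e}) * y ^ nat (nullity k P {e}) * universal_tutte k (contraction P {e}) x y a b"
    unfolding universal_tutte_def sum_distrib_left
    using subset_monomial_contraction[OF P, of "{e}"] e by (intro sum.cong) simp_all
  finally show ?thesis
    by (simp add: nullity_def rank_deficit_def)
qed

lemma satisfies_recursion_universal_tutte:
  assumes k_polymatroids: "\<P> \<subseteq> k_polymatroids k" and minor_closed: "minor_closed \<P>"
    and U: "\<And>P. P \<in> \<P> \<Longrightarrow> U P = universal_tutte k P var_x var_y var_a var_b"
  shows "satisfies_recursion k \<P> U"
  unfolding satisfies_recursion_def
proof (intro ballI conjI impI)
  fix P assume P: "P \<in> \<P>" "ground P = {}"
  then have "is_polymatroid P"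
    using k_polymatroids k_polymatroids_is_polymatroid by blast
  then show "U P = 1"
    using P by (simp add: U universal_tutte_empty)
next
  fix P e assume P: "P \<in> \<P>" and e: "e \<in> ground P"
  have k_polymatroid: "P \<in> k_polymatroids k"
    using P k_polymatroids by blast
  have "deletion P {e} \<in> \<P>" "contraction P {e} \<in> \<P>"
    using e minor_closed_deletion[OF minor_closed P k_polymatroids_is_polymatroid[OF k_polymatroid]]
      minor_closed_contraction[OF minor_closed P] by simp_all
  then show "U P = var_a ^ nat (k - Delta P e) * var_x ^ nat (Delta P e) * U (deletion P {e})
      + var_b ^ nat (k - rank_deficit k P e) * var_y ^ nat (rank_deficit k P e)
        * U (contraction P {e})"
    using universal_tutte_recursion[OF k_polymatroid e] by (simp only: U P)
qed

lemma satisfies_recursion_imp_eq_universal_tutte: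
  assumes recursion: "satisfies_recursion k \<P> U"
    and k_polymatroids: "\<P> \<subseteq> k_polymatroids k" and "minor_closed \<P>" and "P \<in> \<P>"
  shows "U P = universal_tutte k P var_x var_y var_a var_b"
proof -
  have "\<P> \<subseteq> {P. is_polymatroid P}"
    using k_polymatroids k_polymatroids_is_polymatroid by blast
  with \<open>P \<in> \<P>\<close> \<open>minor_closed \<P>\<close> show ?thesis
  proof (induction rule: minor_closed_induct)
    case (empty P)
    then have "is_polymatroid P"
      using k_polymatroids k_polymatroids_is_polymatroid by blast
    then show ?case
      using recursion empty by (simp add: satisfies_recursion_def universal_tutte_empty)
  next
    case (minors P e)
    then have "P \<in> k_polymatroids k"
      using k_polymatroids by blast
    have "U P = var_a ^ nat (k - Delta P e) * var_x ^ nat (Delta P e) * U (deletion P {e})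
        + var_b ^ nat (k - rank_deficit k P e) * var_y ^ nat (rank_deficit k P e)
          * U (contraction P {e})"
      using recursion minors.hyps unfolding satisfies_recursion_def by blast
    also have "\<dots> = universal_tutte k P var_x var_y var_a var_b"
      unfolding minors.IH
      by (rule universal_tutte_recursion[OF \<open>P \<in> k_polymatroids k\<close> minors.hyps(2), symmetric])
    finally show ?case .
  qed
qed

lemma universal_tutte_eq_tutte:
  fixes x y a b :: "'r::field"
  assumes P: "P \<in> k_polymatroids k" and nonzero: "a \<noteq> 0" "b \<noteq> 0"
  shows "universal_tutte k P x y a b =
    a ^ nat (k * int (card (ground P)) - total_rank P) * b ^ nat (total_rank P)
    * tutte k P ((x + b) / b) ((y + a) / a)"
proof -
  note polymatroid = k_polymatroids_is_polymatroid[OF P]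
  have shift: "(x + b) / b - 1 = x / b" "(y + a) / a - 1 = y / a"
    using nonzero by (simp_all add: field_simps)
  have "subset_monomial k P x y a b A =
      a ^ nat (k * int (card (ground P)) - total_rank P) * b ^ nat (total_rank P)
      * ((x / b) ^ nat (corank P A) * (y / a) ^ nat (nullity k P A))"
    if A: "A \<subseteq> ground P" for A
  proof -
    have "a ^ nat (k * int (card (ground P)) - total_rank P) =
        a ^ nat (conullity k P A) * a ^ nat (nullity k P A)"
      unfolding conullity_add_nullity[OF is_polymatroid_finite[OF polymatroid] A, symmetric]
      by (intro power_nat_add conullity_nonneg nullity_nonneg P A)
    moreover have "b ^ nat (total_rank P) = b ^ nat (rank P A) * b ^ nat (corank P A)"
      unfolding rank_add_corank[of P A, symmetric]
      by (intro power_nat_add is_polymatroid_rank_nonneg corank_nonneg polymatroid A)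
    ultimately show ?thesis
      using nonzero by (simp add: subset_monomial_def power_divide)
  qed
  then show ?thesis
    by (simp add: universal_tutte_def tutte_def shift sum_distrib_left
        flip: corank_def nullity_def)
qed

lemma to_fract_power: "to_fract (p ^ n) = to_fract p ^ n"
  by (induction n) simp_all

lemma to_fract_universal_tutte:
  "to_fract (universal_tutte k P x y a b) =
     universal_tutte k P (to_fract x) (to_fract y) (to_fract a) (to_fract b)"
  by (simp add: universal_tutte_def subset_monomial_def to_fract_power)

lemma indet_nonzero: "indet i \<noteq> 0"
  by (simp add: indet_def)

theorem theorem3p7:
  fixes k :: int and \<P> :: "'a polymatroid set"
  assumes "k \<ge> 1"
    and "\<P> \<subseteq> k_polymatroids k"
    and "minor_closed \<P>"
  shows "(\<exists>!U. U \<in> \<P> \<rightarrow>\<^sub>E UNIV \<and> satisfies_recursion k \<P> U) \<and>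
    (\<forall>U. U \<in> \<P> \<rightarrow>\<^sub>E UNIV \<and> satisfies_recursion k \<P> U \<longrightarrow>
      (\<forall>P\<in>\<P>. to_fract (U P) =
          to_fract var_a ^ nat (k * int (card (ground P)) - total_rank P)
          * to_fract var_b ^ nat (total_rank P)
          * tutte k P
              ((to_fract var_x + to_fract var_b) / to_fract var_b)
              ((to_fract var_y + to_fract var_a) / to_fract var_a)))"
proof (intro conjI allI impI ballI)
  let ?V = "\<lambda>P\<in>\<P>. universal_tutte k P var_x var_y var_a var_b"
  have V: "?V \<in> \<P> \<rightarrow>\<^sub>E UNIV \<and> satisfies_recursion k \<P> ?V"
    using satisfies_recursion_universal_tutte[OF assms(2,3)] by simp
  have eq_universal_tutte: "U P = universal_tutte k P var_x var_y var_a var_b"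
    if "U \<in> \<P> \<rightarrow>\<^sub>E UNIV \<and> satisfies_recursion k \<P> U" "P \<in> \<P>" for U P
    using that satisfies_recursion_imp_eq_universal_tutte[OF _ assms(2,3)] by blast
  show "\<exists>!U. U \<in> \<P> \<rightarrow>\<^sub>E UNIV \<and> satisfies_recursion k \<P> U"
    using V by (intro ex1I[of _ ?V] PiE_ext[of _ \<P> "\<lambda>_. UNIV" ?V]) (auto simp: eq_universal_tutte)
  fix U P assume U: "U \<in> \<P> \<rightarrow>\<^sub>E UNIV \<and> satisfies_recursion k \<P> U" and P: "P \<in> \<P>"
  have "P \<in> k_polymatroids k"
    using P assms(2) by blast
  then show "to_fract (U P) =
      to_fract var_a ^ nat (k * int (card (ground P)) - total_rank P)
      * to_fract var_b ^ nat (total_rank P)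
      * tutte k P
          ((to_fract var_x + to_fract var_b) / to_fract var_b)
          ((to_fract var_y + to_fract var_a) / to_fract var_a)"
    by (simp add: eq_universal_tutte[OF U P] to_fract_universal_tutte universal_tutte_eq_tutte
        indet_nonzero)
qed

end
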